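(* Let $G=C_2\times C_2$ be the Klein four-group and let $\lambda(G)$ be its superextension. Then the group $\mathrm{Aut}(\lambda(G))$ of semigroup automorphisms of $\lambda(G)$ is isomorphic to the holomorph $\mathrm{Hol}(G)$ of the group $G$, and hence is isomorphic to the symmetric group $S_4$.
   Context: $C_n$ denotes the cyclic group of order $n$. A family $\mathcal A$ of non-empty subsets of a set $X$ is an upfamily if $A\in\mathcal A$ and $A\subset B\subset X$ imply $B\in\mathcal A$. A family $\mathcal B$ of non-empty subsets of $X$ generates the upfamily $\langle \mathcal B\rangle=\{A\subset X:\exists B\in\mathcal B\ (B\subset A)\}$; we write $\langle B: B\in\mathcal B\rangle$ for it. An upfamily $\mathcal L$ is linked if $A\cap B\neq\emptyset$ for all $A,B\in\mathcal L$. The superextension $\lambda(X)$ is the set of all maximal (with respect to inclusion) linked upfamilies on $X$. For a semigroup $S$ (in particular, a group) with operation $*$, the set $\lambda(S)$ is a semigroup under the (known to be well-defined and associative) operation $$\mathcal A*\mathcal B=\Big\langle\bigcup_{a\in A}a*B_a : A\in\mathcal A,\ \{B_a\}_{a\in A}\subset\mathcal B\Big\rangle .$$ The holomorph $\mathrm{Hol}(G)$ is the semidirect product $G\rtimes\mathrm{Aut}(G)$, i.e. the set $G\times\mathrm{Aut}(G)$ with the operation $(x,f)\star(y,g)=(x\cdot f(y),f\circ g)$. *)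

theory Defs
  imports "HOL-Algebra.Bij" "HOL-Algebra.Elementary_Groups" "HOL-Algebra.Sym_Groups"
begin

section \<open>Superextensions of semigroups and holomorphs of groups\<close>

definition upfamily_on :: "'a set \<Rightarrow> 'a set set \<Rightarrow> bool" where
  "upfamily_on X \<A> \<longleftrightarrow>
     \<A> \<subseteq> Pow X - {{}} \<and> (\<forall>A B. A \<in> \<A> \<and> A \<subseteq> B \<and> B \<subseteq> X \<longrightarrow> B \<in> \<A>)"

definition upfamily_generated :: "'a set \<Rightarrow> 'a set set \<Rightarrow> 'a set set" where
  "upfamily_generated X \<B> = {A. A \<subseteq> X \<and> (\<exists>B\<in>\<B>. B \<subseteq> A)}"

definition linked_upfamily_on :: "'a set \<Rightarrow> 'a set set \<Rightarrow> bool" where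
  "linked_upfamily_on X \<L> \<longleftrightarrow> upfamily_on X \<L> \<and> (\<forall>A\<in>\<L>. \<forall>B\<in>\<L>. A \<inter> B \<noteq> {})"

definition superextension_set :: "'a set \<Rightarrow> 'a set set set" where
  "superextension_set X =
     {\<L>. linked_upfamily_on X \<L> \<and> (\<forall>\<M>. linked_upfamily_on X \<M> \<and> \<L> \<subseteq> \<M> \<longrightarrow> \<M> = \<L>)}"

text \<open>
  The superextension of a semigroup is represented by a monoid record. Its unit field, the
  principal family at the unit of \<open>S\<close>, is irrelevant for the constants \<^const>\<open>hom\<close> and
  \<^const>\<open>AutoGroup\<close>, which look only at the carrier and the multiplication: the elements of
  \<open>AutoGroup (superextension S)\<close> are exactly the semigroup automorphisms.
\<close>

definition superextension :: "('a, 'b) monoid_scheme \<Rightarrow> 'a set set monoid" where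
  "superextension S =
     \<lparr>carrier = superextension_set (carrier S),
      monoid.mult = (\<lambda>\<A> \<B>. upfamily_generated (carrier S)
                {\<Union>a\<in>A. a <#\<^bsub>S\<^esub> B a | A B. A \<in> \<A> \<and> (\<forall>a\<in>A. B a \<in> \<B>)}),
      one = upfamily_generated (carrier S) {{\<one>\<^bsub>S\<^esub>}}\<rparr>"

definition holomorph :: "('a, 'b) monoid_scheme \<Rightarrow> ('a \<times> ('a \<Rightarrow> 'a)) monoid" where
  "holomorph G =
     \<lparr>carrier = carrier G \<times> carrier (AutoGroup G),
      monoid.mult = (\<lambda>(x, f) (y, g). (x \<otimes>\<^bsub>G\<^esub> f y, f \<otimes>\<^bsub>AutoGroup G\<^esub> g)),
      one = (\<one>\<^bsub>G\<^esub>, \<one>\<^bsub>AutoGroup G\<^esub>)\<rparr>"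

end

theory Submission
  imports Defs
begin

text \<open>Besides the group \<open>G\<close> of principal ultrafilters, \<open>\<lambda>(G)\<close> consists of the translates of two
  families \<open>\<box>\<close> and \<open>\<triangle>\<close>: both contain all sets with at least three elements, and in addition the
  two-element sets which contain the unit (for \<open>\<box>\<close>) or avoid it (for \<open>\<triangle>\<close>). Since
  \<open>\<box> * \<box> = \<triangle> * \<triangle> = \<box>\<close> and \<open>\<box> * \<triangle> = \<triangle> * \<box> = \<triangle>\<close>, an automorphism restricts to an automorphism
  \<open>f\<close> of \<open>G\<close>, fixes the idempotent \<open>\<box>\<close> and sends \<open>\<triangle>\<close> to \<open>t * \<triangle>\<close> for some \<open>t \<in> G\<close>; every pair
  \<open>(t, f)\<close> occurs, and pairs compose as in the holomorph. Finally, \<open>(t, f) \<mapsto> (x \<mapsto> t f(x))\<close>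
  identifies the holomorph with all permutations of the four points of \<open>G\<close>, because every
  permutation fixing the unit is an automorphism.\<close>

section \<open>Automorphism groups of magmas\<close>

lemma carrier_AutoGroup_iff:
  "f \<in> carrier (AutoGroup M) \<longleftrightarrow>
     f \<in> hom M M \<and> f \<in> extensional (carrier M) \<and> bij_betw f (carrier M) (carrier M)"
  by (auto simp: AutoGroup_def auto_def Bij_def)

lemma mult_AutoGroup:
  assumes "f \<in> carrier (AutoGroup M)" "g \<in> carrier (AutoGroup M)"
  shows "f \<otimes>\<^bsub>AutoGroup M\<^esub> g = compose (carrier M) f g"
  using assms by (simp add: AutoGroup_def BijGroup_def auto_def)

text \<open>Closure of \<open>G\<close> is what lets the inverse map be evaluated on products. In
  this form symmetry applies to the holomorph as soon as its closure is known.\<close>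

lemma iso_sym_closed:
  assumes "G \<cong> H" and closed: "\<And>x y. x \<in> carrier G \<Longrightarrow> y \<in> carrier G \<Longrightarrow> x \<otimes>\<^bsub>G\<^esub> y \<in> carrier G"
  shows "H \<cong> G"
proof -
  obtain h where h: "h \<in> hom G H" "bij_betw h (carrier G) (carrier H)"
    using assms(1) by (auto simp: is_iso_def iso_def)
  let ?k = "inv_into (carrier G) h"
  have k: "bij_betw ?k (carrier H) (carrier G)"
    by (rule bij_betw_inv_into[OF h(2)])
  have "?k \<in> hom H G"
  proof (rule homI)
    fix u v assume "u \<in> carrier H" "v \<in> carrier H"
    then have u: "?k u \<in> carrier G" "h (?k u) = u" and v: "?k v \<in> carrier G" "h (?k v) = v"
      using k bij_betwE bij_betw_inv_into_right[OF h(2)] by blast+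
    have "u \<otimes>\<^bsub>H\<^esub> v = h (?k u \<otimes>\<^bsub>G\<^esub> ?k v)"
      using hom_mult[OF h(1) u(1) v(1)] u v by simp
    then show "?k (u \<otimes>\<^bsub>H\<^esub> v) = ?k u \<otimes>\<^bsub>G\<^esub> ?k v"
      using closed[OF u(1) v(1)] bij_betw_inv_into_left[OF h(2)] by simp
  qed (use k bij_betwE in blast)
  with k show ?thesis by (auto simp: is_iso_def iso_def)
qed

text \<open>Conjugation by an isomorphism transports automorphisms, so the superextension may be
  replaced by an explicit model. Conjugates are cut down to the carrier because members of
  \<open>AutoGroup\<close> are \<open>extensional\<close>.\<close>

lemma AutoGroup_cong:
  assumes "G \<cong> H" and closed: "\<And>x y. x \<in> carrier G \<Longrightarrow> y \<in> carrier G \<Longrightarrow> x \<otimes>\<^bsub>G\<^esub> y \<in> carrier G"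
  shows "AutoGroup G \<cong> AutoGroup H"
proof -
  obtain h where h: "h \<in> hom G H" "bij_betw h (carrier G) (carrier H)"
    using assms(1) by (auto simp: is_iso_def iso_def)
  let ?k = "inv_into (carrier G) h"
  have k: "bij_betw ?k (carrier H) (carrier G)"
    by (rule bij_betw_inv_into[OF h(2)])
  have hk: "\<And>y. y \<in> carrier H \<Longrightarrow> h (?k y) = y" and kh: "\<And>x. x \<in> carrier G \<Longrightarrow> ?k (h x) = x"
    using bij_betw_inv_into_right[OF h(2)] bij_betw_inv_into_left[OF h(2)] by blast+
  have hC: "\<And>x. x \<in> carrier G \<Longrightarrow> h x \<in> carrier H" and kC: "\<And>y. y \<in> carrier H \<Longrightarrow> ?k y \<in> carrier G"
    using h(2) k bij_betwE by blast+
  have hm: "\<And>x y. x \<in> carrier G \<Longrightarrow> y \<in> carrier G \<Longrightarrow> h (x \<otimes>\<^bsub>G\<^esub> y) = h x \<otimes>\<^bsub>H\<^esub> h y"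
    by (rule hom_mult[OF h(1)])
  have closedH: "u \<otimes>\<^bsub>H\<^esub> v \<in> carrier H" if "u \<in> carrier H" "v \<in> carrier H" for u v
    using that by (metis hC hk hm kC closed)
  have km: "?k (u \<otimes>\<^bsub>H\<^esub> v) = ?k u \<otimes>\<^bsub>G\<^esub> ?k v" if "u \<in> carrier H" "v \<in> carrier H" for u v
    using that by (metis hk hm kC kh closed)
  define F where "F = (\<lambda>f. restrict (h \<circ> f \<circ> ?k) (carrier H))"
  define F' where "F' = (\<lambda>f. restrict (?k \<circ> f \<circ> h) (carrier G))"
  have F: "F f \<in> carrier (AutoGroup H)" if "f \<in> carrier (AutoGroup G)" for f
  proof -
    have f: "f \<in> hom G G" "bij_betw f (carrier G) (carrier G)"
      using that by (auto simp: carrier_AutoGroup_iff)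
    have "bij_betw (h \<circ> f \<circ> ?k) (carrier H) (carrier H)"
      using bij_betw_trans[OF k bij_betw_trans[OF f(2) h(2)]] by (simp add: comp_assoc)
    moreover have "F f \<in> hom H H"
      using f(1) by (auto intro!: homI simp: F_def hm km closedH kC hC hom_in_carrier hom_mult)
    ultimately show ?thesis
      by (auto simp: carrier_AutoGroup_iff F_def cong: bij_betw_cong)
  qed
  have F': "F' f \<in> carrier (AutoGroup G)" if "f \<in> carrier (AutoGroup H)" for f
  proof -
    have f: "f \<in> hom H H" "bij_betw f (carrier H) (carrier H)"
      using that by (auto simp: carrier_AutoGroup_iff)
    have "bij_betw (?k \<circ> f \<circ> h) (carrier G) (carrier G)"
      using bij_betw_trans[OF h(2) bij_betw_trans[OF f(2) k]] by (simp add: comp_assoc)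
    moreover have "F' f \<in> hom G G"
      using f(1) by (auto intro!: homI simp: F'_def hm km closed kC hC hom_in_carrier hom_mult)
    ultimately show ?thesis
      by (auto simp: carrier_AutoGroup_iff F'_def cong: bij_betw_cong)
  qed
  have "bij_betw F (carrier (AutoGroup G)) (carrier (AutoGroup H))"
  proof (rule bij_betw_byWitness[where f' = F'])
    show "\<forall>f\<in>carrier (AutoGroup G). F' (F f) = f"
      by (auto simp: F_def F'_def carrier_AutoGroup_iff hC kh hom_in_carrier intro!: extensionalityI[of _ "carrier G"])
    show "\<forall>f\<in>carrier (AutoGroup H). F (F' f) = f"
      by (auto simp: F_def F'_def carrier_AutoGroup_iff kC hk hom_in_carrier intro!: extensionalityI[of _ "carrier H"])
  qed (use F F' in auto)
  moreover have "F \<in> hom (AutoGroup G) (AutoGroup H)"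
  proof (rule homI)
    fix f g assume fg: "f \<in> carrier (AutoGroup G)" "g \<in> carrier (AutoGroup G)"
    then have "\<And>x. x \<in> carrier G \<Longrightarrow> g x \<in> carrier G"
      by (auto simp: carrier_AutoGroup_iff hom_in_carrier)
    then have "F (compose (carrier G) f g) = compose (carrier H) (F f) (F g)"
      by (auto simp: F_def compose_def fun_eq_iff kC hC kh)
    then show "F (f \<otimes>\<^bsub>AutoGroup G\<^esub> g) = F f \<otimes>\<^bsub>AutoGroup H\<^esub> F g"
      using fg F by (simp add: mult_AutoGroup)
  qed (rule F)
  ultimately show ?thesis by (auto simp: is_iso_def iso_def)
qed

section \<open>Permutations of a finite set and the symmetric group\<close>

lemma BijGroup_iso_sym_group:
  assumes "finite S" "card S = n"
  shows "BijGroup S \<cong> sym_group n"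
proof -
  obtain g where g: "bij_betw g {1..n} S"
    using assms by (metis card_atLeastAtMost diff_Suc_1 finite_atLeastAtMost finite_same_card_bij)
  let ?k = "inv_into {1..n} g"
  have k: "bij_betw ?k S {1..n}" by (rule bij_betw_inv_into[OF g])
  have gk: "\<And>y. y \<in> S \<Longrightarrow> g (?k y) = y" and kg: "\<And>i. i \<in> {1..n} \<Longrightarrow> ?k (g i) = i"
    using bij_betw_inv_into_right[OF g] bij_betw_inv_into_left[OF g] by blast+
  have gC: "\<And>i. i \<in> {1..n} \<Longrightarrow> g i \<in> S" and kC: "\<And>y. y \<in> S \<Longrightarrow> ?k y \<in> {1..n}"
    using g k bij_betwE by blast+
  \<comment> \<open>Members of \<open>sym_group n\<close> fix every point outside
    \<open>{1..n}\<close>, while those of \<open>Bij S\<close> are undefined outside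
    \<open>S\<close>. Hence \<open>F\<close> extends the conjugate by the identity and
    \<open>F'\<close> restricts it.\<close>
  define F where "F = (\<lambda>f i. if i \<in> {1..n} then ?k (f (g i)) else i)"
  define F' where "F' = (\<lambda>p. restrict (g \<circ> p \<circ> ?k) S)"
  have F: "F f permutes {1..n}" if "f \<in> Bij S" for f
  proof (rule bij_imp_permutes)
    have "bij_betw (?k \<circ> f \<circ> g) {1..n} {1..n}"
      using bij_betw_trans[OF g bij_betw_trans[OF _ k, of f S]] that by (simp add: comp_assoc Bij_def)
    then show "bij_betw (F f) {1..n} {1..n}"
      by (rule iffD1[OF bij_betw_cong, rotated]) (simp add: F_def)
  qed (auto simp: F_def)
  have F': "F' p \<in> Bij S" if "p permutes {1..n}" for p
    using bij_betw_trans[OF k bij_betw_trans[OF permutes_imp_bij[OF that] g]]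
    by (auto simp: Bij_def F'_def comp_assoc cong: bij_betw_cong)
  have "bij_betw F (Bij S) {p. p permutes {1..n}}"
  proof (rule bij_betw_byWitness[where f' = F'])
    show "\<forall>f\<in>Bij S. F' (F f) = f"
    proof
      fix f assume "f \<in> Bij S"
      then have "f \<in> extensional S" "\<And>x. x \<in> S \<Longrightarrow> f x \<in> S"
        by (auto simp: Bij_def bij_betwE)
      then show "F' (F f) = f"
        using kC by (auto simp: F_def F'_def gk simp del: One_nat_def intro!: extensionalityI[of _ S])
    qed
    show "\<forall>p\<in>{p. p permutes {1..n}}. F (F' p) = p"
    proof
      fix p assume "p \<in> {p. p permutes {1..n}}"
      then have p: "p permutes {1..n}" by simp
      show "F (F' p) = p"
      proof
        fix i show "F (F' p) i = p i"
        proof (cases "i \<in> {1..n}")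
          case True
          then have "p i \<in> {1..n}" using permutes_in_image[OF p] by blast
          with True show ?thesis using gC[OF True] by (simp add: F_def F'_def kg del: One_nat_def)
        next
          case False
          then show ?thesis using permutes_not_in[OF p] by (auto simp: F_def)
        qed
      qed
    qed
  qed (use F F' in auto)
  moreover have "F \<in> hom (BijGroup S) (sym_group n)"
  proof (rule homI)
    fix f h assume fh: "f \<in> carrier (BijGroup S)" "h \<in> carrier (BijGroup S)"
    then have hS: "\<And>x. x \<in> S \<Longrightarrow> h x \<in> S" by (auto simp: BijGroup_def Bij_def bij_betwE)
    have "F (compose S f h) = F f \<circ> F h"
    proof (rule ext)
      fix i show "F (compose S f h) i = (F f \<circ> F h) i"
      proof (cases "i \<in> {1..n}")
        case True
        then show ?thesis using hS[OF gC] kC[OF hS[OF gC]] gC[OF True]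
          by (simp add: F_def compose_def gk del: One_nat_def atLeastAtMost_iff)
      qed (auto simp: F_def)
    qed
    then show "F (f \<otimes>\<^bsub>BijGroup S\<^esub> h) = F f \<otimes>\<^bsub>sym_group n\<^esub> F h"
      using fh by (auto simp: BijGroup_def sym_group_mult)
  qed (use F in \<open>auto simp: BijGroup_def sym_group_carrier\<close>)
  ultimately show ?thesis
    by (auto simp: is_iso_def iso_def BijGroup_def sym_group_def)
qed

section \<open>Superextensions\<close>

text \<open>If every member of \<open>\<L>\<close> met \<open>A\<close>, adding all supersets of
  \<open>A\<close> would give a larger linked upfamily. So some member misses \<open>A\<close>, and
  the complement of \<open>A\<close> lies above it.\<close>

lemma maximal_linked_compl:
  assumes "\<L> \<in> superextension_set X" "A \<subseteq> X" "A \<noteq> {}" "A \<notin> \<L>"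
  shows "X - A \<in> \<L>"
proof -
  have L: "upfamily_on X \<L>" and link: "\<And>B C. B \<in> \<L> \<Longrightarrow> C \<in> \<L> \<Longrightarrow> B \<inter> C \<noteq> {}"
    and mx: "\<And>\<M>. linked_upfamily_on X \<M> \<Longrightarrow> \<L> \<subseteq> \<M> \<Longrightarrow> \<M> = \<L>"
    using assms(1) unfolding superextension_set_def linked_upfamily_on_def by blast+
  have "\<exists>B\<in>\<L>. B \<inter> A = {}"
  proof (rule ccontr)
    assume "\<not> (\<exists>B\<in>\<L>. B \<inter> A = {})"
    then have meet: "\<And>B. B \<in> \<L> \<Longrightarrow> B \<inter> A \<noteq> {}" by blast
    let ?M = "\<L> \<union> {C. A \<subseteq> C \<and> C \<subseteq> X}"
    have "upfamily_on X ?M"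
      using L assms(3) unfolding upfamily_on_def by (auto; blast)
    moreover have "\<forall>B\<in>?M. \<forall>C\<in>?M. B \<inter> C \<noteq> {}"
      using link meet assms(3) by blast
    ultimately have "?M = \<L>"
      by (intro mx) (auto simp: linked_upfamily_on_def)
    then show False using assms(2,4) by blast
  qed
  then obtain B where "B \<in> \<L>" "B \<inter> A = {}" by blast
  moreover have "B \<subseteq> X - A" using L calculation unfolding upfamily_on_def by blast
  ultimately show ?thesis using L unfolding upfamily_on_def by (meson Diff_subset)
qed

text \<open>A linked family cannot contain both a set and its complement, so one that already has a
  member of every complementary pair has no room to grow.\<close>

lemma superextension_setI:
  assumes "linked_upfamily_on X \<L>" "\<And>A. A \<subseteq> X \<Longrightarrow> A \<notin> \<L> \<Longrightarrow> X - A \<in> \<L>"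
  shows "\<L> \<in> superextension_set X"
proof -
  have "\<M> = \<L>" if M: "linked_upfamily_on X \<M>" "\<L> \<subseteq> \<M>" for \<M>
  proof
    show "\<M> \<subseteq> \<L>"
    proof
      fix A assume A: "A \<in> \<M>"
      then have "A \<subseteq> X" using M by (auto simp: linked_upfamily_on_def upfamily_on_def)
      moreover have "X - A \<notin> \<M>" using A M(1) unfolding linked_upfamily_on_def by blast
      ultimately show "A \<in> \<L>" using assms(2) M(2) by blast
    qed
  qed (rule M)
  then show ?thesis using assms(1) by (auto simp: superextension_set_def)
qed

lemma superextension_set_eqI:
  assumes "\<L> \<in> superextension_set X" "\<M> \<in> superextension_set X" "\<L> \<subseteq> \<M>"
  shows "\<L> = \<M>"
  using assms unfolding superextension_set_def by blast

text \<open>The inclusion \<open>a <# B a \<subseteq> C\<close> means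
  \<open>B a \<subseteq> inv a <# C\<close>. The best choice for \<open>B a\<close> is thus all of
  \<open>inv a <# C\<close>, and the best index set consists of all \<open>a\<close> for which this
  belongs to \<open>\<B>\<close>; upward closure does the rest.\<close>

lemma (in group) mem_mult_superextension:
  assumes "upfamily_on (carrier G) \<A>" "upfamily_on (carrier G) \<B>"
  shows "C \<in> \<A> \<otimes>\<^bsub>superextension G\<^esub> \<B> \<longleftrightarrow>
     C \<subseteq> carrier G \<and> {x \<in> carrier G. inv x <# C \<in> \<B>} \<in> \<A>"
proof -
  have mult: "\<A> \<otimes>\<^bsub>superextension G\<^esub> \<B> = {C. C \<subseteq> carrier G \<and>
      (\<exists>D\<in>{\<Union>a\<in>A. a <# B a | A B. A \<in> \<A> \<and> (\<forall>a\<in>A. B a \<in> \<B>)}. D \<subseteq> C)}"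
    by (simp add: superextension_def upfamily_generated_def)
  have multI: "C \<in> \<A> \<otimes>\<^bsub>superextension G\<^esub> \<B>"
    if "P \<in> \<A>" "\<forall>a\<in>P. Q a \<in> \<B>" "(\<Union>a\<in>P. a <# Q a) \<subseteq> C" "C \<subseteq> carrier G" for P Q
    unfolding mult
    by (intro CollectI conjI that(4) bexI[where P = "\<lambda>D. D \<subseteq> C", OF that(3)] exI[of _ P] exI[of _ Q] refl that(1,2))
  have A: "A \<subseteq> carrier G" if "A \<in> \<A>" for A using that assms unfolding upfamily_on_def by blast
  have B: "A \<subseteq> carrier G" if "A \<in> \<B>" for A using that assms unfolding upfamily_on_def by blast
  have upA: "D \<in> \<A>" if "A \<in> \<A>" "A \<subseteq> D" "D \<subseteq> carrier G" for A D
    using that assms(1) unfolding upfamily_on_def by blast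
  have upB: "D \<in> \<B>" if "A \<in> \<B>" "A \<subseteq> D" "D \<subseteq> carrier G" for A D
    using that assms(2) unfolding upfamily_on_def by blast
  have mem: "{x \<in> carrier G. inv x <# C \<in> \<B>} \<in> \<A>"
    if "C \<subseteq> carrier G" "P \<in> \<A>" "\<And>a. a \<in> P \<Longrightarrow> Q a \<in> \<B>" "(\<Union>a\<in>P. a <# Q a) \<subseteq> C" for P Q
  proof (rule upA[OF that(2)])
    show "P \<subseteq> {x \<in> carrier G. inv x <# C \<in> \<B>}"
    proof
      fix a assume a: "a \<in> P"
      then have aG: "a \<in> carrier G" using A that by blast
      have "Q a \<subseteq> inv a <# C"
      proof
        fix q assume q: "q \<in> Q a"
        then have qG: "q \<in> carrier G" using B that a by blast
        have "a \<otimes> q \<in> C" using q a that(4) by (auto simp: l_coset_def)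
        then show "q \<in> inv a <# C"
          unfolding l_coset_def using aG qG by (auto simp: m_assoc[symmetric] intro!: bexI[of _ "a \<otimes> q"])
      qed
      moreover have "inv a <# C \<subseteq> carrier G" using aG that(1) by (simp add: l_coset_subset_G)
      ultimately have "inv a <# C \<in> \<B>" using upB that(3)[OF a] by blast
      then show "a \<in> {x \<in> carrier G. inv x <# C \<in> \<B>}" using aG by simp
    qed
  qed auto
  show ?thesis
  proof (intro iffI conjI)
    assume "C \<in> \<A> \<otimes>\<^bsub>superextension G\<^esub> \<B>"
    then obtain P Q where PQ: "P \<in> \<A>" "\<forall>a\<in>P. Q a \<in> \<B>" "(\<Union>a\<in>P. a <# Q a) \<subseteq> C"
      and C: "C \<subseteq> carrier G"
      unfolding mult by blast
    show "C \<subseteq> carrier G" by (rule C)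
    show "{x \<in> carrier G. inv x <# C \<in> \<B>} \<in> \<A>"
      by (rule mem[OF C PQ(1) _ PQ(3)]) (use PQ(2) in blast)
  next
    assume C: "C \<subseteq> carrier G \<and> {x \<in> carrier G. inv x <# C \<in> \<B>} \<in> \<A>"
    let ?P = "{x \<in> carrier G. inv x <# C \<in> \<B>}"
    have "(\<Union>a\<in>?P. a <# (inv a <# C)) \<subseteq> C"
      using C by (auto simp: lcos_m_assoc lcos_mult_one)
    moreover have "\<forall>a\<in>?P. inv a <# C \<in> \<B>" by simp
    ultimately show "C \<in> \<A> \<otimes>\<^bsub>superextension G\<^esub> \<B>"
      using C by (intro multI[of ?P "\<lambda>a. inv a <# C"]) blast+
  qed
qed

section \<open>The Klein four-group\<close>

text \<open>Order four and exponent two characterize the Klein four-group without naming its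
  elements. Inverses disappear from all computations, and commutativity follows.\<close>

locale klein_four = group +
  assumes card_carrier: "card (carrier G) = 4"
    and square [simp]: "x \<in> carrier G \<Longrightarrow> x \<otimes> x = \<one>"
begin

lemma finite_carrier [simp]: "finite (carrier G)"
  using card_carrier card.infinite by fastforce

lemma inv_self [simp]: "x \<in> carrier G \<Longrightarrow> inv x = x"
  by (simp add: inv_equality)

lemma comm: "x \<in> carrier G \<Longrightarrow> y \<in> carrier G \<Longrightarrow> x \<otimes> y = y \<otimes> x"
  by (metis inv_mult_group inv_self m_closed)

lemma mult_cancel_self [simp]: "x \<in> carrier G \<Longrightarrow> y \<in> carrier G \<Longrightarrow> x \<otimes> (x \<otimes> y) = y"
  by (simp add: m_assoc[symmetric])

lemma carrier_cases:
  obtains a b c where "carrier G = {\<one>, a, b, c}" "distinct [\<one>, a, b, c]"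
proof -
  have "card (carrier G - {\<one>}) = 3" using card_carrier by simp
  then obtain a b c where "carrier G - {\<one>} = {a, b, c}" "a \<noteq> b" "b \<noteq> c" "a \<noteq> c"
    unfolding card_3_iff by blast
  moreover from this have "carrier G = {\<one>, a, b, c}" using one_closed by blast
  ultimately show thesis using that[of a b c] by auto
qed

lemma fourth_unique:
  assumes "u \<in> carrier G" "v \<in> carrier G" "w \<in> carrier G" "p \<in> carrier G" "q \<in> carrier G"
    and "distinct [u, v, w]" "p \<notin> {u, v, w}" "q \<notin> {u, v, w}"
  shows "p = q"
proof (rule ccontr)
  assume "p \<noteq> q"
  then have "distinct [u, v, w, p, q]" using assms by auto
  then have "card {u, v, w, p, q} = 5" using distinct_card[of "[u, v, w, p, q]"] by simp
  moreover have "card {u, v, w, p, q} \<le> card (carrier G)" using assms by (intro card_mono) auto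
  ultimately show False using card_carrier by simp
qed

lemma mult_notin:
  assumes "x \<in> carrier G" "y \<in> carrier G" "distinct [\<one>, x, y]"
  shows "x \<otimes> y \<notin> {\<one>, x, y}"
proof -
  have "x \<otimes> y \<noteq> \<one>" using assms inv_equality[of y x] by (metis comm inv_self distinct_length_2_or_more)
  moreover have "x \<otimes> y \<noteq> x" "x \<otimes> y \<noteq> y" using assms by (auto simp: l_cancel_one r_cancel_one)
  ultimately show ?thesis by simp
qed

text \<open>The product of two distinct involutions is the third one.\<close>

lemma bij_fixing_one_hom:
  assumes f: "bij_betw f (carrier G) (carrier G)" "f \<one> = \<one>"
  shows "f \<in> hom G G"
proof (rule homI)
  have fC: "f x \<in> carrier G" if "x \<in> carrier G" for x using f that bij_betwE by blast
  then show "\<And>x. x \<in> carrier G \<Longrightarrow> f x \<in> carrier G" .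
  have inj: "f x = f y \<longleftrightarrow> x = y" if "x \<in> carrier G" "y \<in> carrier G" for x y
    using that f(1) by (auto simp: bij_betw_def inj_on_def)
  fix x y assume xy: "x \<in> carrier G" "y \<in> carrier G"
  show "f (x \<otimes> y) = f x \<otimes> f y"
  proof (cases "distinct [\<one>, x, y]")
    case True
    have d: "distinct [\<one>, f x, f y]" using True xy inj[of \<one>] inj[of x y] f(2) by auto
    \<comment> \<open>Both \<open>f (x \<otimes> y)\<close> and \<open>f x \<otimes> f y\<close>
      avoid the same three distinct elements, and only one element of the group is left.\<close>
    have "f (x \<otimes> y) \<notin> {\<one>, f x, f y}"
      using mult_notin[OF xy True] xy inj[of "x \<otimes> y" \<one>] inj[of "x \<otimes> y"] f(2) by auto
    then show ?thesis
      using fourth_unique[OF one_closed fC fC fC m_closed[OF fC fC] d _ mult_notin[OF fC fC d]] xy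
      by simp
  next
    case False
    then consider "x = \<one>" | "y = \<one>" | "x = y" by auto
    then show ?thesis by cases (simp_all add: xy fC[OF xy(1)] fC[OF xy(2)] f(2))
  qed
qed

section \<open>The holomorph as the group of all permutations of the carrier\<close>

lemma holomorph_closed:
  assumes "p \<in> carrier (holomorph G)" "q \<in> carrier (holomorph G)"
  shows "p \<otimes>\<^bsub>holomorph G\<^esub> q \<in> carrier (holomorph G)"
proof -
  have "f \<otimes>\<^bsub>AutoGroup G\<^esub> g \<in> carrier (AutoGroup G)"
    if "f \<in> carrier (AutoGroup G)" "g \<in> carrier (AutoGroup G)" for f g
    using that subgroup.m_closed[OF subgroup_auto] by (simp add: AutoGroup_def)
  then show ?thesis using assms
    by (auto simp: holomorph_def carrier_AutoGroup_iff hom_in_carrier)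
qed

lemma holomorph_iso_BijGroup: "holomorph G \<cong> BijGroup (carrier G)"
proof -
  define F where "F = (\<lambda>(t, f). \<lambda>x\<in>carrier G. t \<otimes> f x)"
  \<comment> \<open>As \<open>f \<one> = \<one>\<close>, the translation part is the value at
    \<open>\<one>\<close>. Being its own inverse, it is removed by multiplying with it once more,
    which leaves a bijection fixing \<open>\<one>\<close>.\<close>
  define F' where "F' = (\<lambda>p. (p \<one>, \<lambda>x\<in>carrier G. p \<one> \<otimes> p x))"
  have transl: "bij_betw (\<lambda>x. t \<otimes> x) (carrier G) (carrier G)" if "t \<in> carrier G" for t
    using that by (intro bij_betw_byWitness[where f' = "\<lambda>x. t \<otimes> x"]) auto
  have F: "F p \<in> Bij (carrier G)" if "p \<in> carrier (holomorph G)" for p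
    using that bij_betw_trans[OF _ transl, of "snd p" "carrier G" "fst p"]
    by (auto simp: F_def holomorph_def carrier_AutoGroup_iff Bij_def comp_def cong: bij_betw_cong)
  have F': "F' p \<in> carrier (holomorph G)" if "p \<in> Bij (carrier G)" for p
  proof -
    have p: "bij_betw p (carrier G) (carrier G)" "p \<one> \<in> carrier G"
      using that by (auto simp: Bij_def bij_betwE)
    let ?f = "\<lambda>x\<in>carrier G. p \<one> \<otimes> p x"
    have "bij_betw ?f (carrier G) (carrier G)"
      using bij_betw_trans[OF p(1) transl[OF p(2)]] by (simp add: comp_def cong: bij_betw_cong)
    moreover from this have "?f \<in> hom G G" by (rule bij_fixing_one_hom) (simp add: p)
    ultimately show ?thesis using p
      by (simp add: F'_def holomorph_def carrier_AutoGroup_iff)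
  qed
  have "bij_betw F (carrier (holomorph G)) (Bij (carrier G))"
  proof (rule bij_betw_byWitness[where f' = F'])
    show "\<forall>p\<in>carrier (holomorph G). F' (F p) = p"
      by (auto simp: F_def F'_def holomorph_def carrier_AutoGroup_iff hom_one hom_in_carrier
          intro!: extensionalityI[of _ "carrier G"])
    show "\<forall>p\<in>Bij (carrier G). F (F' p) = p"
      by (auto simp: F_def F'_def Bij_def bij_betwE intro!: extensionalityI[of _ "carrier G"])
  qed (use F F' in auto)
  moreover have "F \<in> hom (holomorph G) (BijGroup (carrier G))"
  proof (rule homI)
    fix p q assume pq: "p \<in> carrier (holomorph G)" "q \<in> carrier (holomorph G)"
    then have "F (p \<otimes>\<^bsub>holomorph G\<^esub> q) = compose (carrier G) (F p) (F q)"
      by (auto simp: F_def holomorph_def mult_AutoGroup compose_def fun_eq_iff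
          carrier_AutoGroup_iff hom_in_carrier hom_mult m_assoc)
    then show "F (p \<otimes>\<^bsub>holomorph G\<^esub> q) = F p \<otimes>\<^bsub>BijGroup (carrier G)\<^esub> F q"
      using F[OF pq(1)] F[OF pq(2)] by (simp add: BijGroup_def)
  qed (use F in \<open>simp add: BijGroup_def\<close>)
  ultimately show ?thesis by (auto simp: is_iso_def iso_def BijGroup_def)
qed

end

section \<open>The superextension of the Klein four-group\<close>

text \<open>\<open>Pt x\<close> stands for the principal ultrafilter at \<open>x\<close>. A maximal linked upfamily without
  singletons contains all sets with at least three elements and one set of each of the three
  complementary pairs of two-element sets; \<open>Tw True x\<close> chooses the sets containing \<open>x\<close> and
  \<open>Tw False x\<close> the sets avoiding it, which exhausts the eight choices.\<close>

datatype 'a mls = Pt (pos: 'a) | Tw bool (pos: 'a)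

context klein_four
begin

text \<open>A model of \<lambda>(G) in which positions multiply as in \<open>G\<close>. The two
  shapes of \<open>Tw\<close> form a group of order two with \<open>True\<close> neutral, whence
  \<open>s = t\<close>, and \<open>Pt\<close> acts as a unit adjoined to it.\<close>

definition mls_magma :: "'a mls monoid" where
  "mls_magma = \<lparr>carrier = {k. pos k \<in> carrier G},
     monoid.mult = (\<lambda>k l. case k of
        Pt x \<Rightarrow> (case l of Pt y \<Rightarrow> Pt (x \<otimes> y) | Tw t y \<Rightarrow> Tw t (x \<otimes> y))
      | Tw s x \<Rightarrow> (case l of Pt y \<Rightarrow> Tw s (x \<otimes> y) | Tw t y \<Rightarrow> Tw (s = t) (x \<otimes> y))),
     one = Pt \<one>\<rparr>"

lemma carrier_mls_magma [simp]: "k \<in> carrier mls_magma \<longleftrightarrow> pos k \<in> carrier G"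
  by (simp add: mls_magma_def)

lemma mult_mls_magma [simp]:
  "Pt x \<otimes>\<^bsub>mls_magma\<^esub> Pt y = Pt (x \<otimes> y)"
  "Pt x \<otimes>\<^bsub>mls_magma\<^esub> Tw t y = Tw t (x \<otimes> y)"
  "Tw s x \<otimes>\<^bsub>mls_magma\<^esub> Pt y = Tw s (x \<otimes> y)"
  "Tw s x \<otimes>\<^bsub>mls_magma\<^esub> Tw t y = Tw (s = t) (x \<otimes> y)"
  by (simp_all add: mls_magma_def)

lemma pos_mult [simp]: "pos (k \<otimes>\<^bsub>mls_magma\<^esub> l) = pos k \<otimes> pos l"
  by (cases k; cases l) simp_all

definition family :: "'a mls \<Rightarrow> 'a set set" where
  "family k = {C. C \<subseteq> carrier G \<and>
     (case k of Pt x \<Rightarrow> x \<in> C | Tw s x \<Rightarrow> 3 \<le> card C \<or> card C = 2 \<and> (x \<in> C) = s)}"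

lemma mem_family [simp]:
  "C \<in> family (Pt x) \<longleftrightarrow> C \<subseteq> carrier G \<and> x \<in> C"
  "C \<in> family (Tw s x) \<longleftrightarrow> C \<subseteq> carrier G \<and> (3 \<le> card C \<or> card C = 2 \<and> (x \<in> C) = s)"
  by (simp_all add: family_def)

section \<open>The families are maximal linked\<close>

lemma card_compl: "C \<subseteq> carrier G \<Longrightarrow> card (carrier G - C) = 4 - card C"
  by (simp add: card_Diff_subset finite_subset[OF _ finite_carrier] card_carrier)

lemma card_le: "C \<subseteq> carrier G \<Longrightarrow> card C \<le> 4"
  using card_mono[OF finite_carrier, of C] card_carrier by simp

lemma upfamily_family: "upfamily_on (carrier G) (family k)"
proof (cases k)
  case (Tw s x)
  have "B \<in> family k" if "A \<in> family k" "A \<subseteq> B" "B \<subseteq> carrier G" for A B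
  proof -
    have fin: "finite B" using that(3) finite_carrier finite_subset by blast
    \<comment> \<open>A proper superset of a member has at least three elements, so the condition on
      \<open>x\<close> matters only when \<open>A = B\<close>.\<close>
    have "card A \<le> card B" by (rule card_mono[OF fin that(2)])
    moreover have "A = B" if "card A = card B" by (rule card_subset_eq[OF fin \<open>A \<subseteq> B\<close> that])
    ultimately show ?thesis using that Tw by (cases "card A = card B") auto
  qed
  moreover have "{} \<notin> family k" using Tw by simp
  ultimately show ?thesis unfolding upfamily_on_def using Tw by auto
qed (auto simp: upfamily_on_def)

text \<open>Disjoint members of a \<open>Tw\<close> family have at least two elements each, so they
  are complementary pairs. Exactly one of these contains the position, although membership in the
  family demands the same answer of both.\<close>

lemma family_linked:
  assumes "pos k \<in> carrier G" "A \<in> family k" "B \<in> family k"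
  shows "A \<inter> B \<noteq> {}"
proof (cases k)
  case (Tw s x)
  show ?thesis
  proof
    assume disj: "A \<inter> B = {}"
    have sub: "A \<subseteq> carrier G" "B \<subseteq> carrier G" and "2 \<le> card A" "2 \<le> card B"
      using assms Tw by auto
    moreover have "card (A \<union> B) = card A + card B"
      using sub finite_carrier finite_subset disj by (intro card_Un_disjoint) blast+
    moreover have "card (A \<union> B) \<le> 4" using sub by (intro card_le) blast
    ultimately have "card A = 2" "card B = 2" "card (A \<union> B) = card (carrier G)"
      using card_carrier by linarith+
    moreover from this have "A \<union> B = carrier G"
      using sub by (intro card_subset_eq) auto
    ultimately show False using assms Tw disj by auto
  qed
qed (use assms in auto)

lemma family_in_superextension:
  assumes "pos k \<in> carrier G"
  shows "family k \<in> superextension_set (carrier G)"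
proof (rule superextension_setI)
  show "linked_upfamily_on (carrier G) (family k)"
    using upfamily_family family_linked[OF assms] by (auto simp: linked_upfamily_on_def)
  show "carrier G - A \<in> family k" if A: "A \<subseteq> carrier G" "A \<notin> family k" for A
  proof (cases k)
    case (Tw s x)
    \<comment> \<open>The complement then has at least three elements, or it is a pair that answers
      \<open>x \<in> C\<close> the other way.\<close>
    then have "card A \<le> 1 \<or> card A = 2 \<and> (x \<in> A) \<noteq> s" using A by auto
    then show ?thesis using Tw A card_compl[OF A(1)] assms by auto
  qed (use A assms in auto)
qed

section \<open>Classification of the maximal linked upfamilies\<close>

lemma two_subsets:
  assumes "A \<subseteq> {u, v, w, z}" "card A = 2"
  shows "A \<in> {{u, v}, {u, w}, {u, z}, {v, w}, {v, z}, {w, z}}"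
proof -
  obtain x y where A: "A = {x, y}" "x \<noteq> y" using assms(2) unfolding card_2_iff by blast
  then have "x \<in> {u, v, w, z}" "y \<in> {u, v, w, z}" using assms(1) by simp_all
  with A(2) show ?thesis
    unfolding A(1) by (elim insertE emptyE) (simp_all add: doubleton_eq_iff)
qed

text \<open>By maximality a single inclusion between \<open>L\<close> and a known family suffices. A
  singleton member forces a principal ultrafilter; otherwise the two-element members decide.\<close>

lemma superextension_cases:
  assumes L: "L \<in> superextension_set (carrier G)"
  obtains k where "pos k \<in> carrier G" "L = family k"
proof -
  have link: "A \<inter> B \<noteq> {}" if "A \<in> L" "B \<in> L" for A B
    using L that unfolding superextension_set_def linked_upfamily_on_def by blast
  have sub: "A \<subseteq> carrier G" if "A \<in> L" for A
    using L that unfolding superextension_set_def linked_upfamily_on_def upfamily_on_def by blast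
  note result = that
  show thesis
  proof (cases "\<exists>x\<in>carrier G. {x} \<in> L")
    case True
    then obtain x where x: "x \<in> carrier G" "{x} \<in> L" by blast
    have "L \<subseteq> family (Pt x)"
      using link[OF x(2)] sub by auto
    then show thesis
      using result[of "Pt x"] superextension_set_eqI[OF L family_in_superextension, of "Pt x"] x(1) by simp
  next
    case False
    have compl: "carrier G - A \<in> L" if "A \<subseteq> carrier G" "A \<noteq> {}" "A \<notin> L" for A
      by (rule maximal_linked_compl[OF L that])
    \<comment> \<open>Otherwise the complement of \<open>A\<close>, with at most one element, would
      be a member; it can be neither empty nor a singleton.\<close>
    have large: "A \<in> L" if A: "A \<subseteq> carrier G" "3 \<le> card A" for A
    proof (rule ccontr)
      assume "A \<notin> L"
      then have B: "carrier G - A \<in> L" using compl[OF A(1)] A(2) by (cases "A = {}") simp_all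
      have "card (carrier G - A) \<le> 1" using card_compl[OF A(1)] A(2) by linarith
      then have "carrier G - A = {} \<or> (\<exists>x. carrier G - A = {x})"
        by (auto simp: le_Suc_eq card_1_singleton_iff)
      moreover have "{} \<notin> L" using link by blast
      ultimately show False using B False sub[OF B] by fastforce
    qed
    obtain a b c where G: "carrier G = {\<one>, a, b, c}" and d: "distinct [\<one>, a, b, c]"
      by (rule carrier_cases)
    \<comment> \<open>Since the large sets are in \<open>L\<close>, only the six two-element sets
      need checking to place a \<open>Tw\<close> family inside \<open>L\<close>.\<close>
    have *: thesis
      if x: "x \<in> carrier G"
        and A: "\<And>A. A \<in> {{\<one>, a}, {\<one>, b}, {\<one>, c}, {a, b}, {a, c}, {b, c}} \<Longrightarrow> (x \<in> A) = s \<Longrightarrow> A \<in> L" for x s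
    proof -
      have "C \<in> L" if "C \<in> family (Tw s x)" for C
      proof -
        have C: "C \<subseteq> carrier G" "3 \<le> card C \<or> card C = 2 \<and> (x \<in> C) = s" using that by simp_all
        then consider "3 \<le> card C" | "card C = 2" "(x \<in> C) = s" by blast
        then show ?thesis
        proof cases
          case 1 then show ?thesis by (rule large[OF C(1)])
        next
          case 2
          have "C \<subseteq> {\<one>, a, b, c}" using C(1) G by simp
          then show ?thesis by (rule A[OF two_subsets[OF _ 2(1)] 2(2)])
        qed
      qed
      then have "family (Tw s x) \<subseteq> L" by blast
      with x have "family (Tw s x) = L"
        by (intro superextension_set_eqI[OF family_in_superextension L]) simp_all
      then show thesis using result[of "Tw s x"] x by simp
    qed
    have compl2: "A \<in> L \<or> B \<in> L" if "A \<noteq> {}" "A \<union> B = carrier G" "A \<inter> B = {}" for A B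
    proof -
      have "B = carrier G - A" using that by blast
      then show ?thesis using compl[of A] that by blast
    qed
    have "{\<one>, a} \<in> L \<or> {b, c} \<in> L" "{\<one>, b} \<in> L \<or> {a, c} \<in> L" "{\<one>, c} \<in> L \<or> {a, b} \<in> L"
      by (rule compl2; use d G in auto)+
    \<comment> \<open>View the chosen two-element sets as edges on the four points. One from each
      complementary pair gives either the star at a point (odd cases) or the triangle avoiding it
      (even cases), the point running through \<open>\<one>\<close>, \<open>a\<close>,
      \<open>b\<close>, \<open>c\<close>.\<close>
    then consider
        "{\<one>, a} \<in> L" "{\<one>, b} \<in> L" "{\<one>, c} \<in> L" | "{b, c} \<in> L" "{a, c} \<in> L" "{a, b} \<in> L"
      | "{\<one>, a} \<in> L" "{a, c} \<in> L" "{a, b} \<in> L" | "{b, c} \<in> L" "{\<one>, b} \<in> L" "{\<one>, c} \<in> L"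
      | "{b, c} \<in> L" "{\<one>, b} \<in> L" "{a, b} \<in> L" | "{\<one>, a} \<in> L" "{a, c} \<in> L" "{\<one>, c} \<in> L"
      | "{b, c} \<in> L" "{a, c} \<in> L" "{\<one>, c} \<in> L" | "{\<one>, a} \<in> L" "{\<one>, b} \<in> L" "{a, b} \<in> L"
      by blast
    then show thesis
    proof cases
      case 1 then show ?thesis using d by (intro *[of \<one> True]) (auto simp: G)
    next
      case 2 then show ?thesis using d by (intro *[of \<one> False]) (auto simp: G)
    next
      case 3 then show ?thesis using d by (intro *[of a True]) (auto simp: G insert_commute)
    next
      case 4 then show ?thesis using d by (intro *[of a False]) (auto simp: G)
    next
      case 5 then show ?thesis using d by (intro *[of b True]) (auto simp: G)
    next
      case 6 then show ?thesis using d by (intro *[of b False]) (auto simp: G)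
    next
      case 7 then show ?thesis using d by (intro *[of c True]) (auto simp: G)
    next
      case 8 then show ?thesis using d by (intro *[of c False]) (auto simp: G)
    qed
  qed
qed

text \<open>Singletons single out and locate the principal families. For two \<open>Tw\<close>
  families at different positions, the pair of positions forces equal shapes, while
  \<open>{pos k, z}\<close> with \<open>z\<close> off both positions forces different ones; at equal
  positions \<open>{pos k, z}\<close> compares the shapes.\<close>

lemma inj_family: "inj_on family (carrier mls_magma)"
proof (rule inj_onI)
  fix k l assume "k \<in> carrier mls_magma" "l \<in> carrier mls_magma" and eq: "family k = family l"
  then have kl: "pos k \<in> carrier G" "pos l \<in> carrier G" by simp_all
  have iff: "C \<in> family k \<longleftrightarrow> C \<in> family l" for C by (simp add: eq)
  have "\<exists>z\<in>carrier G. z \<notin> {x, y}" for x y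
  proof (rule ccontr)
    assume "\<not> ?thesis"
    then have "card (carrier G) \<le> card {x, y}" by (intro card_mono) auto
    then show False using card_insert_le_m1[of 2 "{y}" x] card_carrier by (simp add: card_insert_if split: if_splits)
  qed
  then obtain z where z: "z \<in> carrier G" "z \<noteq> pos k" "z \<noteq> pos l" by blast
  show "k = l"
    using kl z iff[of "{pos k}"] iff[of "{pos l}"] iff[of "{pos k, z}"] iff[of "{pos k, pos l}"]
    by (cases k; cases l) (auto simp: card_insert_if split: if_splits)
qed

section \<open>Products of the families\<close>

lemma mem_l_coset: "x \<in> carrier G \<Longrightarrow> y \<in> carrier G \<Longrightarrow> C \<subseteq> carrier G \<Longrightarrow> y \<in> x <# C \<longleftrightarrow> x \<otimes> y \<in> C"
  unfolding l_coset_def by (auto simp: subset_iff intro!: bexI[of _ "x \<otimes> y"])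

lemma card_l_coset: "x \<in> carrier G \<Longrightarrow> C \<subseteq> carrier G \<Longrightarrow> card (x <# C) = card C"
proof -
  assume xC: "x \<in> carrier G" "C \<subseteq> carrier G"
  have "x <# C = (\<lambda>y. x \<otimes> y) ` C" by (auto simp: l_coset_def)
  moreover have "inj_on (\<lambda>y. x \<otimes> y) C" using xC by (intro inj_onI) (simp add: subset_iff)
  ultimately show ?thesis by (simp add: card_image)
qed

text \<open>The membership criterion reduces the claim to computing the set \<open>?D\<close> of
  those \<open>x\<close> for which \<open>x <# C\<close> is in the second family, and testing it
  against the first.\<close>

lemma family_mult:
  assumes "pos k \<in> carrier G" "pos l \<in> carrier G"
  shows "family k \<otimes>\<^bsub>superextension G\<^esub> family l = family (k \<otimes>\<^bsub>mls_magma\<^esub> l)"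
proof (rule Set.set_eqI)
  fix C
  show "C \<in> family k \<otimes>\<^bsub>superextension G\<^esub> family l \<longleftrightarrow> C \<in> family (k \<otimes>\<^bsub>mls_magma\<^esub> l)"
  proof (cases "C \<subseteq> carrier G")
    case C: True
    let ?D = "{x \<in> carrier G. x <# C \<in> family l}"
    have cos: "x <# C \<subseteq> carrier G" if "x \<in> carrier G" for x
      using C that by (rule l_coset_subset_G)
    have "{x \<in> carrier G. inv x <# C \<in> family l} = ?D" by auto
    then have lhs: "C \<in> family k \<otimes>\<^bsub>superextension G\<^esub> family l \<longleftrightarrow> ?D \<in> family k"
      using C mem_mult_superextension[OF upfamily_family upfamily_family] by simp
    have coset: "{x \<in> carrier G. x \<otimes> y \<in> C} = y <# C" if "y \<in> carrier G" for y
      using mem_l_coset[OF that _ C] cos[OF that] comm[OF that] by auto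
    show ?thesis
    proof (cases l)
      case (Pt y)
      then have y: "y \<in> carrier G" using assms by simp
      have "?D = y <# C"
        unfolding coset[OF y, symmetric] using Pt y C cos by (auto simp: mem_l_coset)
      then show ?thesis using lhs Pt y assms C cos[OF y] comm[OF y]
        by (cases k) (auto simp: mem_l_coset card_l_coset)
    next
      case (Tw t y)
      then have y: "y \<in> carrier G" using assms by simp
      \<comment> \<open>Translation preserves size, so only pairs \<open>C\<close> see the shape
        \<open>t\<close>. The complement taken for \<open>t = False\<close> negates the later test
        \<open>x \<in> ?D\<close>, and this turns the shape \<open>s\<close> into
        \<open>s = t\<close>.\<close>
      have "?D = (if 3 \<le> card C then carrier G else if card C = 2 then
          (if t then y <# C else carrier G - (y <# C)) else {})"
        unfolding coset[OF y, symmetric] using Tw y C cos by (auto simp: mem_l_coset card_l_coset)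
      then show ?thesis using lhs Tw y assms C cos[OF y] comm[OF y]
        by (cases k) (auto simp: mem_l_coset card_l_coset card_carrier card_compl)
    qed
  next
    case False
    then show ?thesis
      using mem_mult_superextension[OF upfamily_family upfamily_family]
      by (simp add: family_def)
  qed
qed

lemma mls_magma_iso_superextension: "mls_magma \<cong> superextension G"
proof -
  have C: "carrier (superextension G) = superextension_set (carrier G)"
    by (simp add: superextension_def)
  have "family ` carrier mls_magma = carrier (superextension G)"
    unfolding C using family_in_superextension by (auto elim!: superextension_cases)
  with inj_family have "bij_betw family (carrier mls_magma) (carrier (superextension G))"
    by (simp add: bij_betw_def)
  moreover have "family \<in> hom mls_magma (superextension G)"
    by (rule homI) (simp_all add: C family_in_superextension family_mult)
  ultimately show ?thesis by (auto simp: is_iso_def iso_def)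
qed

section \<open>Automorphisms of the superextension\<close>

text \<open>Squares separate the shapes: every \<open>Pt x\<close> squares to
  \<open>Pt \<one>\<close> and every \<open>Tw s x\<close> to \<open>Tw True \<one>\<close>. The
  elements \<open>Pt x\<close>, \<open>Tw True \<one>\<close> and \<open>Tw False \<one>\<close>
  generate everything, so \<open>f\<close> and \<open>t\<close> determine the automorphism.\<close>

lemma mls_automorphism_values:
  assumes \<phi>: "\<phi> \<in> carrier (AutoGroup mls_magma)"
  defines "f \<equiv> \<lambda>x. pos (\<phi> (Pt x))" and "t \<equiv> pos (\<phi> (Tw False \<one>))"
  shows "t \<in> carrier G" "f \<in> hom G G" "bij_betw f (carrier G) (carrier G)"
    and "x \<in> carrier G \<Longrightarrow> \<phi> (Pt x) = Pt (f x)"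
    and "x \<in> carrier G \<Longrightarrow> \<phi> (Tw s x) = Tw s (if s then f x else t \<otimes> f x)"
proof -
  have hom: "\<phi> \<in> hom mls_magma mls_magma" and bij: "bij_betw \<phi> (carrier mls_magma) (carrier mls_magma)"
    using \<phi> by (auto simp: carrier_AutoGroup_iff)
  have mult: "\<phi> (k \<otimes>\<^bsub>mls_magma\<^esub> l) = \<phi> k \<otimes>\<^bsub>mls_magma\<^esub> \<phi> l" if "pos k \<in> carrier G" "pos l \<in> carrier G" for k l
    using hom_mult[OF hom] that by simp
  have C: "pos (\<phi> k) \<in> carrier G" if "pos k \<in> carrier G" for k
    using hom_in_carrier[OF hom, of k] that by simp
  have inj: "k = l" if "\<phi> k = \<phi> l" "pos k \<in> carrier G" "pos l \<in> carrier G" for k l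
    using bij that by (auto simp: bij_betw_def inj_on_def)
  have surj: "\<exists>k. pos k \<in> carrier G \<and> \<phi> k = l" if "pos l \<in> carrier G" for l
    using bij_betw_imp_surj_on[OF bij] that by (metis carrier_mls_magma imageE)
  have one: "\<phi> (Pt \<one>) = Pt \<one>"
  proof -
    obtain k where k: "pos k \<in> carrier G" "\<phi> k = Pt \<one>" using surj[of "Pt \<one>"] by auto
    have "k \<otimes>\<^bsub>mls_magma\<^esub> Pt \<one> = k" using k by (cases k) simp_all
    then have "Pt \<one> \<otimes>\<^bsub>mls_magma\<^esub> \<phi> (Pt \<one>) = Pt \<one>" using mult[of k "Pt \<one>"] k by simp
    then show ?thesis using C[of "Pt \<one>"] by (cases "\<phi> (Pt \<one>)") simp_all
  qed
  have Pt: "\<phi> (Pt x) = Pt (f x)" if "x \<in> carrier G" for x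
    using mult[of "Pt x" "Pt x"] that one by (cases "\<phi> (Pt x)") (simp_all add: f_def)
  have fC: "f x \<in> carrier G" if "x \<in> carrier G" for x using C[of "Pt x"] that by (simp add: f_def)
  \<comment> \<open>A principal image would square to \<open>Pt \<one>\<close>, giving
    \<open>Tw True \<one>\<close> the same image as \<open>Pt \<one>\<close>.\<close>
  have Tw_image: "\<exists>s' y. y \<in> carrier G \<and> \<phi> (Tw s x) = Tw s' y" if x: "x \<in> carrier G" for s x
  proof (cases "\<phi> (Tw s x)")
    case (Pt y)
    then have y: "y \<in> carrier G" using C[of "Tw s x"] x by simp
    have "\<phi> (Tw True \<one>) = \<phi> (Pt \<one>)"
      using mult[of "Tw s x" "Tw s x"] Pt x y one by simp
    then show ?thesis using inj[of "Tw True \<one>" "Pt \<one>"] by simp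
  next
    case (Tw s' y)
    then show ?thesis using C[of "Tw s x"] x by auto
  qed
  show "f \<in> hom G G"
  proof (rule homI)
    fix x y assume xy: "x \<in> carrier G" "y \<in> carrier G"
    then have "Pt (f (x \<otimes> y)) = Pt (f x \<otimes> f y)"
      using mult[of "Pt x" "Pt y"]
      by (simp only: Pt[OF xy(1)] Pt[OF xy(2)] Pt[OF m_closed[OF xy]] mls.sel mult_mls_magma)
    then show "f (x \<otimes> y) = f x \<otimes> f y" by simp
  qed (rule fC)
  have surjf: "\<exists>x\<in>carrier G. f x = y" if y: "y \<in> carrier G" for y
  proof -
    obtain k where k: "pos k \<in> carrier G" "\<phi> k = Pt y" using surj[of "Pt y"] y by auto
    show ?thesis
    proof (cases k)
      case (Pt x)
      then show ?thesis using k by (intro bexI[of _ x]) (simp_all add: f_def)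
    next
      case (Tw s x)
      then show ?thesis using k Tw_image[of x s] by simp
    qed
  qed
  moreover have "inj_on f (carrier G)"
  proof (rule inj_onI)
    fix x y assume "x \<in> carrier G" "y \<in> carrier G" "f x = f y"
    then show "x = y" using inj[of "Pt x" "Pt y"] Pt by simp
  qed
  ultimately show "bij_betw f (carrier G) (carrier G)"
    using fC by (auto simp: bij_betw_def image_def)
  \<comment> \<open>The image is an idempotent of the form \<open>Tw s y\<close>, and the square of
    any such element is \<open>Tw True \<one>\<close>.\<close>
  have True_one: "\<phi> (Tw True \<one>) = Tw True \<one>"
  proof -
    obtain s y where "y \<in> carrier G" "\<phi> (Tw True \<one>) = Tw s y" using Tw_image[of \<one> True] by auto
    then show ?thesis using mult[of "Tw True \<one>" "Tw True \<one>"] by simp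
  qed
  have True_x: "\<phi> (Tw True x) = Tw True (f x)" if "x \<in> carrier G" for x
    using mult[of "Tw True \<one>" "Pt x"] True_one Pt that fC by simp
  show tC: "t \<in> carrier G" using C[of "Tw False \<one>"] by (simp add: t_def)
  \<comment> \<open>As \<open>f\<close> is onto, every \<open>Tw True y\<close> is already the image
    of some \<open>Tw True x\<close>, so injectivity leaves only the shape
    \<open>False\<close>.\<close>
  have False_one: "\<phi> (Tw False \<one>) = Tw False t"
  proof -
    obtain s where s: "\<phi> (Tw False \<one>) = Tw s t" using Tw_image[of \<one> False] by (auto simp: t_def)
    obtain x where x: "x \<in> carrier G" "f x = t" using surjf[OF tC] by blast
    have "\<not> s"
    proof
      assume s
      then have "\<phi> (Tw False \<one>) = \<phi> (Tw True x)" using True_x s x by simp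
      then show False using inj[of "Tw False \<one>" "Tw True x"] x by simp
    qed
    with s show ?thesis by simp
  qed
  show "\<phi> (Pt x) = Pt (f x)" if "x \<in> carrier G" by (rule Pt[OF that])
  show "\<phi> (Tw s x) = Tw s (if s then f x else t \<otimes> f x)" if "x \<in> carrier G"
    using mult[of "Tw False \<one>" "Pt x"] True_x False_one Pt that by (cases s) simp_all
qed

lemma holomorph_iso_AutoGroup_mls: "holomorph G \<cong> AutoGroup mls_magma"
proof -
  define F where "F = (\<lambda>(t, f). \<lambda>k\<in>carrier mls_magma. case k of
      Pt x \<Rightarrow> Pt (f x) | Tw s x \<Rightarrow> Tw s (if s then f x else t \<otimes> f x))"
  define F' where "F' = (\<lambda>\<phi> :: 'a mls \<Rightarrow> 'a mls. (pos (\<phi> (Tw False \<one>)), \<lambda>x\<in>carrier G. pos (\<phi> (Pt x))))"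
  have F_Pt: "F (t, f) (Pt x) = Pt (f x)"
    and F_Tw: "F (t, f) (Tw s x) = Tw s (if s then f x else t \<otimes> f x)"
    if "x \<in> carrier G" for t f s x
    using that by (simp_all add: F_def)
  have hol: "t \<in> carrier G" "f \<in> hom G G" "bij_betw f (carrier G) (carrier G)" "f \<in> extensional (carrier G)"
      "f \<one> = \<one>" "\<And>x. x \<in> carrier G \<Longrightarrow> f x \<in> carrier G"
    if "(t, f) \<in> carrier (holomorph G)" for t f
    using that by (auto simp: holomorph_def carrier_AutoGroup_iff hom_one is_group hom_in_carrier)
  have F: "F p \<in> carrier (AutoGroup mls_magma)" if p: "p \<in> carrier (holomorph G)" for p
  proof (cases p)
    case (Pair t f)
    note h = hol[OF p[unfolded Pair]]
    have fm: "f (x \<otimes> y) = f x \<otimes> f y" if "x \<in> carrier G" "y \<in> carrier G" for x y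
      by (rule hom_mult[OF h(2) that])
    define g where "g = inv_into (carrier G) f"
    have g: "\<And>x. x \<in> carrier G \<Longrightarrow> g x \<in> carrier G" "\<And>x. x \<in> carrier G \<Longrightarrow> f (g x) = x"
        "\<And>x. x \<in> carrier G \<Longrightarrow> g (f x) = x"
      using h(3) bij_betw_inv_into[OF h(3)] bij_betw_inv_into_right[OF h(3)] bij_betw_inv_into_left[OF h(3)]
      unfolding g_def by (blast dest: bij_betwE)+
    have pos: "pos (F p k) \<in> carrier G" if "pos k \<in> carrier G" for k
      using that h(1,6) unfolding Pair by (cases k) (simp_all add: F_Pt F_Tw)
    have "bij_betw (F p) (carrier mls_magma) (carrier mls_magma)"
    proof (rule bij_betw_byWitness)
      \<comment> \<open>Multiplying by \<open>t\<close> undoes the translation, since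
        \<open>t\<close> is its own inverse.\<close>
      let ?g = "\<lambda>k. case k of Pt x \<Rightarrow> Pt (g x) | Tw s x \<Rightarrow> Tw s (if s then g x else g (t \<otimes> x))"
      show "\<forall>k\<in>carrier mls_magma. ?g (F p k) = k"
      proof
        fix k assume "k \<in> carrier mls_magma"
        then show "?g (F p k) = k" using g h(1,6) unfolding Pair by (cases k) (simp_all add: F_Pt F_Tw)
      qed
      show "\<forall>k\<in>carrier mls_magma. F p (?g k) = k"
      proof
        fix k assume "k \<in> carrier mls_magma"
        then show "F p (?g k) = k" using g h(1,6) unfolding Pair by (cases k) (simp_all add: F_Pt F_Tw)
      qed
      show "F p ` carrier mls_magma \<subseteq> carrier mls_magma" using pos by auto
      show "?g ` carrier mls_magma \<subseteq> carrier mls_magma"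
        using g(1) h(1) by (auto split: mls.split)
    qed
    moreover have "F p \<in> hom mls_magma mls_magma"
    proof (rule homI)
      fix k l assume "k \<in> carrier mls_magma" "l \<in> carrier mls_magma"
      then have kl: "pos k \<in> carrier G" "pos l \<in> carrier G" by simp_all
      \<comment> \<open>Brings \<open>t\<close> to the front. With two factors of shape
        \<open>False\<close> the two copies of \<open>t\<close> cancel, matching the product shape
        \<open>True\<close>.\<close>
      have swap: "x \<otimes> (t \<otimes> y) = t \<otimes> (x \<otimes> y)" if "x \<in> carrier G" "y \<in> carrier G" for x y
        using that h(1) by (metis comm m_assoc)
      show "F p (k \<otimes>\<^bsub>mls_magma\<^esub> l) = F p k \<otimes>\<^bsub>mls_magma\<^esub> F p l"
        using kl h(1,6) unfolding Pair
        by (cases k; cases l) (simp_all add: F_Pt F_Tw fm m_assoc swap)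
    qed (use pos in simp)
    moreover have "F p \<in> extensional (carrier mls_magma)" by (simp add: F_def Pair)
    ultimately show ?thesis by (simp add: carrier_AutoGroup_iff)
  qed
  have F': "F' \<phi> \<in> carrier (holomorph G)" "F (F' \<phi>) = \<phi>"
    if \<phi>: "\<phi> \<in> carrier (AutoGroup mls_magma)" for \<phi>
  proof -
    note v = mls_automorphism_values[OF \<phi>]
    have "(\<lambda>x\<in>carrier G. pos (\<phi> (Pt x))) \<in> hom G G"
      using v(2) by (auto simp: hom_def)
    then show "F' \<phi> \<in> carrier (holomorph G)"
      using v(1,3) by (simp add: F'_def holomorph_def carrier_AutoGroup_iff cong: bij_betw_cong)
    show "F (F' \<phi>) = \<phi>"
    proof (rule extensionalityI[of _ "carrier mls_magma"])
      show "F (F' \<phi>) \<in> extensional (carrier mls_magma)" by (simp add: F_def F'_def)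
      show "\<phi> \<in> extensional (carrier mls_magma)" using \<phi> by (simp add: carrier_AutoGroup_iff)
      fix k assume "k \<in> carrier mls_magma"
      then have k: "pos k \<in> carrier G" by simp
      show "F (F' \<phi>) k = \<phi> k"
      proof (cases k)
        case (Pt x)
        then show ?thesis using k v(4)[of x] by (simp add: F'_def F_Pt)
      next
        case (Tw s x)
        then show ?thesis using k v(5)[of x s] by (simp add: F'_def F_Tw)
      qed
    qed
  qed
  have "bij_betw F (carrier (holomorph G)) (carrier (AutoGroup mls_magma))"
  proof (rule bij_betw_byWitness[where f' = F'])
    show "\<forall>p\<in>carrier (holomorph G). F' (F p) = p"
    proof
      fix p assume p: "p \<in> carrier (holomorph G)"
      obtain t f where Pair: "p = (t, f)" by (cases p)
      note h = hol[OF p[unfolded Pair]]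
      have "(\<lambda>x\<in>carrier G. pos (F (t, f) (Pt x))) = f"
        using h(4) by (intro extensionalityI[of _ "carrier G"]) (simp_all add: F_Pt)
      then show "F' (F p) = p" using h(1,5) by (simp add: F'_def F_Tw Pair)
    qed
  qed (use F F' in auto)
  moreover have "F \<in> hom (holomorph G) (AutoGroup mls_magma)"
  proof (rule homI)
    fix p q assume pq: "p \<in> carrier (holomorph G)" "q \<in> carrier (holomorph G)"
    obtain t f u g where Pair: "p = (t, f)" "q = (u, g)" by (cases p; cases q)
    note hp = hol[OF pq(1)[unfolded Pair]] and hq = hol[OF pq(2)[unfolded Pair]]
    have fg: "f \<otimes>\<^bsub>AutoGroup G\<^esub> g = compose (carrier G) f g"
      using pq Pair by (intro mult_AutoGroup) (auto simp: holomorph_def)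
    \<comment> \<open>On shape \<open>False\<close> this is \<open>t \<otimes> f (u \<otimes> g x) =
      (t \<otimes> f u) \<otimes> f (g x)\<close>, the multiplication rule of the holomorph.\<close>
    have "F (p \<otimes>\<^bsub>holomorph G\<^esub> q) = compose (carrier mls_magma) (F p) (F q)"
    proof (rule extensionalityI[of _ "carrier mls_magma"])
      show "F (p \<otimes>\<^bsub>holomorph G\<^esub> q) \<in> extensional (carrier mls_magma)"
        by (simp add: F_def split: prod.split)
      fix k assume "k \<in> carrier mls_magma"
      then show "F (p \<otimes>\<^bsub>holomorph G\<^esub> q) k = compose (carrier mls_magma) (F p) (F q) k"
        using hp(1,6) hq(1,6) hom_mult[OF hp(2)]
        by (cases k) (simp_all add: holomorph_def Pair fg compose_def F_Pt F_Tw m_assoc)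
    qed simp
    then show "F (p \<otimes>\<^bsub>holomorph G\<^esub> q) = F p \<otimes>\<^bsub>AutoGroup mls_magma\<^esub> F q"
      using F pq by (simp add: mult_AutoGroup)
  qed (rule F)
  ultimately show ?thesis by (auto simp: is_iso_def iso_def)
qed

lemma AutoGroup_superextension_iso_holomorph: "AutoGroup (superextension G) \<cong> holomorph G"
proof -
  have "holomorph G \<cong> AutoGroup (superextension G)"
    using holomorph_iso_AutoGroup_mls
      AutoGroup_cong[OF mls_magma_iso_superextension]
    by (rule iso_trans) simp
  then show ?thesis by (rule iso_sym_closed) (rule holomorph_closed)
qed

end

section \<open>Transfer from the product of two cyclic groups, and the conclusion\<close>

lemma klein_fourI:
  fixes G :: "('a, 'b) monoid_scheme"
  assumes "group G" "G \<cong> integer_mod_group 2 \<times>\<times> integer_mod_group 2"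
  shows "klein_four G"
proof -
  let ?H = "integer_mod_group 2 \<times>\<times> integer_mod_group 2"
  interpret group G by fact
  obtain h where h: "h \<in> hom G ?H" "bij_betw h (carrier G) (carrier ?H)"
    using assms(2) by (auto simp: is_iso_def iso_def)
  have H: "group ?H" by (simp add: DirProd_group)
  have "x \<otimes>\<^bsub>G\<^esub> x = \<one>\<^bsub>G\<^esub>" if x: "x \<in> carrier G" for x
  proof -
    have "h (x \<otimes>\<^bsub>G\<^esub> x) = h x \<otimes>\<^bsub>?H\<^esub> h x" using hom_mult[OF h(1) x x] .
    \<comment> \<open>Squaring doubles each coordinate modulo 2.\<close>
    also have "\<dots> = \<one>\<^bsub>?H\<^esub>" by (cases "h x") simp
    also have "\<dots> = h \<one>\<^bsub>G\<^esub>" using hom_one[OF h(1) is_group H] by simp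
    finally show ?thesis using h(2) x by (auto simp: bij_betw_def inj_on_def)
  qed
  moreover have "card (carrier G) = 4"
    using bij_betw_same_card[OF h(2)] by (simp add: carrier_integer_mod_group card_cartesian_product)
  ultimately show ?thesis by unfold_locales simp_all
qed

theorem proposition2p1:
  fixes G :: "('a, 'b) monoid_scheme"
  assumes "group G"
    and "G \<cong> integer_mod_group 2 \<times>\<times> integer_mod_group 2"
  shows "AutoGroup (superextension G) \<cong> holomorph G
         \<and> AutoGroup (superextension G) \<cong> sym_group 4"
proof -
  interpret klein_four G using assms by (rule klein_fourI)
  have "holomorph G \<cong> sym_group 4"
    using holomorph_iso_BijGroup BijGroup_iso_sym_group[OF finite_carrier card_carrier]
    by (rule iso_trans)
  with AutoGroup_superextension_iso_holomorph show ?thesis using iso_trans by blast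
qed

end
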